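(* Let $n\geq 4$ and $2\leq k\leq\lfloor n/2\rfloor$, and let $G_{n,k}^{C}$ be the flip graph of $k$-element subsets of $[n]$ (defined in the context). Then: (i) if $n$ is even, then $G_{n,k}^{C}$ has no rainbow cycle; (ii) if $n$ is odd and $k=2$, then $G_{n,2}^{C}$ has a rainbow Hamilton cycle; (iii) if $n$ is odd and $k=2$, then $G_{n,2}^{C}$ has two edge-disjoint rainbow Hamilton cycles; (iv) if $n$ is odd and $3\leq k<n/3$, then $G_{n,k}^{C}$ has a rainbow cycle.
   Context: $G_{n,k}^{C}$ is the undirected graph whose vertices are the $k$-element subsets of $[n]=\{1,\dots,n\}$, with an edge between $A$ and $B$ whenever $A\setminus B=\{x\}$ and $B\setminus A=\{y\}$ for some $x\neq y$; this edge is labeled with the pair $\{x,y\}=A\triangle B$. A rainbow cycle (1-rainbow cycle) is a cycle (no repeated vertices) along which each of the $\binom{n}{2}$ pairs $\{x,y\}\subseteq[n]$ appears exactly once as an edge label. A rainbow Hamilton cycle is a rainbow cycle visiting every vertex. *)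

theory Defs
  imports Complex_Main
begin

definition flip_verts :: "nat \<Rightarrow> nat \<Rightarrow> nat set set" where
  "flip_verts n k = {A. A \<subseteq> {1..n} \<and> card A = k}"

definition flip_edges :: "nat \<Rightarrow> nat \<Rightarrow> nat set set set" where
  "flip_edges n k = {{A, B} | A B. A \<in> flip_verts n k \<and> B \<in> flip_verts n k \<and>
     (\<exists>x y. x \<noteq> y \<and> A - B = {x} \<and> B - A = {y})}"

definition flip_label :: "nat set \<Rightarrow> nat set \<Rightarrow> nat set" where
  "flip_label A B = sym_diff A B"

text \<open>A cycle in a simple graph is given by the list of its vertices in cyclic order, without
  repeating the start vertex; the step with index \<open>i\<close> joins \<open>c ! i\<close> to its cyclic successor.\<close>

definition cyc_succ :: "'a list \<Rightarrow> nat \<Rightarrow> 'a" where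
  "cyc_succ c i = c ! (Suc i mod length c)"

definition cycle_edges :: "'a list \<Rightarrow> 'a set set" where
  "cycle_edges c = {{c ! i, cyc_succ c i} | i. i < length c}"

definition graph_cycle :: "'a set \<Rightarrow> 'a set set \<Rightarrow> 'a list \<Rightarrow> bool" where
  "graph_cycle V E c \<longleftrightarrow>
     length c \<ge> 3 \<and> distinct c \<and> set c \<subseteq> V \<and> cycle_edges c \<subseteq> E"

definition rainbow_cycle :: "nat \<Rightarrow> nat \<Rightarrow> nat set list \<Rightarrow> bool" where
  "rainbow_cycle n k c \<longleftrightarrow> graph_cycle (flip_verts n k) (flip_edges n k) c \<and>
     (\<forall>P. P \<subseteq> {1..n} \<and> card P = 2 \<longrightarrow>
        (\<exists>!i. i < length c \<and> flip_label (c ! i) (cyc_succ c i) = P))"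

definition rainbow_hamilton_cycle :: "nat \<Rightarrow> nat \<Rightarrow> nat set list \<Rightarrow> bool" where
  "rainbow_hamilton_cycle n k c \<longleftrightarrow> rainbow_cycle n k c \<and> set c = flip_verts n k"

end

theory Submission
  imports Defs "HOL-Number_Theory.Cong"
begin

text \<open>
  Non-existence: each element lies in \<open>n - 1\<close> labels, and each of these toggles its membership.
  Along a closed walk the membership is toggled an even number of times, so \<open>n\<close> is odd.

  Existence: let \<open>n = 2 l + 1\<close> and take the elements to be the residues modulo \<open>n\<close>. Keep the
  elements \<open>1, \<dots>, k - 1\<close> fixed and let one further element walk from \<open>0\<close> to \<open>k\<close> in \<open>l\<close> steps
  whose cyclic lengths are \<open>1, \<dots>, l\<close> in some order. The last set of this block is the first one
  rotated by \<open>1\<close>, so the \<open>n\<close> rotations of the block close up to a cycle that uses each of the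
  \<open>n l\<close> labels once. It remains to choose the walk so that no two sets within the block are
  rotations of each other. For \<open>k = 2\<close> the cycle has as many vertices as the whole graph, and the
  reflection \<open>y \<mapsto> - y\<close> of it has no edge in common with it.
\<close>

section \<open>Closed walks in the flip graph\<close>

definition step_label :: "nat set list \<Rightarrow> nat \<Rightarrow> nat set" where
  "step_label c i = flip_label (c ! i) (cyc_succ c i)"

lemma finite_flip_verts: "finite (flip_verts n k)"
  unfolding flip_verts_def by (rule finite_subset[of _ "Pow {1..n}"]) auto

lemma card_flip_verts: "card (flip_verts n k) = n choose k"
  unfolding flip_verts_def by (simp add: n_subsets)

lemma card_flip_verts_containing:
  assumes "a \<in> {1..n}"
  shows "card {A \<in> flip_verts n (Suc k). a \<in> A} = (n - 1) choose k"
proof -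
  let ?S = "{B. B \<subseteq> {1..n} - {a} \<and> card B = k}"
  have fin: "finite B" if "B \<subseteq> {1..n} - {a}" for B
    using that by (rule finite_subset) simp
  have "{A \<in> flip_verts n (Suc k). a \<in> A} = insert a ` ?S"
  proof (intro equalityI subsetI)
    fix A assume "A \<in> {A \<in> flip_verts n (Suc k). a \<in> A}"
    then have "A - {a} \<in> ?S" "A = insert a (A - {a})"
      by (auto simp: flip_verts_def)
    then show "A \<in> insert a ` ?S" by blast
  next
    fix A assume "A \<in> insert a ` ?S"
    then obtain B where "A = insert a B" "B \<subseteq> {1..n} - {a}" "card B = k" by blast
    then show "A \<in> {A \<in> flip_verts n (Suc k). a \<in> A}"
      using assms fin[of B] by (auto simp: flip_verts_def card_insert_if)
  qed
  moreover have "inj_on (insert a) ?S"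
    by (auto simp: inj_on_def)
  ultimately show ?thesis
    using assms by (simp add: card_image n_subsets)
qed

lemma doubleton_in_flip_edges_iff:
  "{A, B} \<in> flip_edges n k \<longleftrightarrow> A \<in> flip_verts n k \<and> B \<in> flip_verts n k \<and>
     (\<exists>y z. y \<noteq> z \<and> A - B = {y} \<and> B - A = {z})"
  unfolding flip_edges_def mem_Collect_eq doubleton_eq_iff by metis

lemma flip_label_in_flip_verts:
  assumes "{A, B} \<in> flip_edges n k"
  shows "flip_label A B \<in> flip_verts n 2"
proof -
  obtain y z where yz: "y \<noteq> z" "A - B = {y}" "B - A = {z}"
    using assms unfolding doubleton_in_flip_edges_iff by blast
  have "A \<subseteq> {1..n}" "B \<subseteq> {1..n}"
    using assms by (simp_all add: doubleton_in_flip_edges_iff flip_verts_def)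
  then have "y \<in> {1..n}" "z \<in> {1..n}"
    using yz(2,3) by blast+
  then show ?thesis
    using yz by (simp add: flip_label_def flip_verts_def)
qed

lemma bij_betw_iff_ex1_preimage:
  assumes "f ` A \<subseteq> B"
  shows "bij_betw f A B \<longleftrightarrow> (\<forall>b\<in>B. \<exists>!a. a \<in> A \<and> f a = b)"
proof
  assume "bij_betw f A B"
  then show "\<forall>b\<in>B. \<exists>!a. a \<in> A \<and> f a = b"
    unfolding bij_betw_def inj_on_def by blast
next
  assume "\<forall>b\<in>B. \<exists>!a. a \<in> A \<and> f a = b"
  then show "bij_betw f A B"
    using assms unfolding bij_betw_def inj_on_def by blast
qed

lemma rainbow_cycle_iff_bij_betw:
  "rainbow_cycle n k c \<longleftrightarrow> graph_cycle (flip_verts n k) (flip_edges n k) c \<and>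
     bij_betw (step_label c) {..<length c} (flip_verts n 2)"
proof (cases "graph_cycle (flip_verts n k) (flip_edges n k) c")
  case True
  then have "{c ! i, cyc_succ c i} \<in> flip_edges n k" if "i < length c" for i
    using that unfolding graph_cycle_def cycle_edges_def by blast
  then have "step_label c ` {..<length c} \<subseteq> flip_verts n 2"
    unfolding step_label_def by (blast intro: flip_label_in_flip_verts)
  from bij_betw_iff_ex1_preimage[OF this] show ?thesis
    using True by (simp add: rainbow_cycle_def step_label_def flip_verts_def)
qed (simp add: rainbow_cycle_def)

lemma card_set_rainbow_cycle:
  assumes "rainbow_cycle n k c"
  shows "card (set c) = n choose 2"
proof -
  have "distinct c" and "bij_betw (step_label c) {..<length c} (flip_verts n 2)"
    using assms by (simp_all add: rainbow_cycle_iff_bij_betw graph_cycle_def)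
  then show ?thesis
    using bij_betw_same_card by (fastforce simp: distinct_card card_flip_verts)
qed

lemma rainbow_cycle_2_imp_hamilton:
  assumes "rainbow_cycle n 2 c"
  shows "rainbow_hamilton_cycle n 2 c"
proof -
  have "set c \<subseteq> flip_verts n 2"
    using assms by (simp add: rainbow_cycle_def graph_cycle_def)
  then have "set c = flip_verts n 2"
    using card_set_rainbow_cycle[OF assms]
    by (simp add: card_subset_eq finite_flip_verts card_flip_verts)
  then show ?thesis
    using assms by (simp add: rainbow_hamilton_cycle_def)
qed

lemma cyc_succ_map_upt:
  assumes "v m = v 0" "t < m"
  shows "cyc_succ (map v [0..<m]) t = v (Suc t)"
  using assms by (cases "Suc t = m") (simp_all add: cyc_succ_def)

lemma cycle_edges_map_upt:
  assumes "v m = v 0"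
  shows "cycle_edges (map v [0..<m]) = {{v t, v (Suc t)} | t. t < m}"
  using cyc_succ_map_upt[OF assms] by (force simp: cycle_edges_def)

lemma rainbow_cycle_map_upt:
  assumes "v m = v 0" "inj_on v {..<m}" "m = n choose 2" "3 \<le> m"
    and edge: "\<And>t. t < m \<Longrightarrow> {v t, v (Suc t)} \<in> flip_edges n k"
    and label_inj: "inj_on (\<lambda>t. flip_label (v t) (v (Suc t))) {..<m}"
  shows "rainbow_cycle n k (map v [0..<m])"
proof -
  let ?c = "map v [0..<m]" and ?lab = "\<lambda>t. flip_label (v t) (v (Suc t))"
  have "?lab ` {..<m} \<subseteq> flip_verts n 2"
    using flip_label_in_flip_verts[OF edge] by auto
  then have "?lab ` {..<m} = flip_verts n 2"
    using card_image[OF label_inj] assms(3)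
    by (simp add: card_subset_eq finite_flip_verts card_flip_verts)
  then have "bij_betw ?lab {..<m} (flip_verts n 2)"
    using label_inj by (simp add: bij_betw_def)
  then have "bij_betw (step_label ?c) {..<length ?c} (flip_verts n 2)"
    using bij_betw_cong[of "{..<m}" "step_label ?c" ?lab] cyc_succ_map_upt[of v, OF assms(1)]
    by (simp add: step_label_def)
  moreover have "graph_cycle (flip_verts n k) (flip_edges n k) ?c"
    using assms cycle_edges_map_upt[OF assms(1)]
    by (auto simp: graph_cycle_def distinct_map lessThan_atLeast0 doubleton_in_flip_edges_iff)
  ultimately show ?thesis
    by (simp add: rainbow_cycle_iff_bij_betw)
qed

section \<open>Parity\<close>

lemma even_card_changes_iff:
  "even (card {i. i < m \<and> f i \<noteq> f (Suc i)}) \<longleftrightarrow> f 0 = f m" for f :: "nat \<Rightarrow> bool"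
proof (induction m)
  case (Suc m)
  have "{i. i < Suc m \<and> f i \<noteq> f (Suc i)} =
      (if f m \<noteq> f (Suc m) then insert m {i. i < m \<and> f i \<noteq> f (Suc i)}
       else {i. i < m \<and> f i \<noteq> f (Suc i)})"
    by (auto simp: less_Suc_eq)
  then show ?case
    using Suc.IH by auto
qed simp

lemma even_card_cyclic_changes:
  fixes p :: "'a \<Rightarrow> bool"
  shows "even (card {i. i < length c \<and> p (c ! i) \<noteq> p (cyc_succ c i)})"
proof -
  have "{i. i < length c \<and> p (c ! i) \<noteq> p (cyc_succ c i)} =
      {i. i < length c \<and> p (c ! (i mod length c)) \<noteq> p (c ! (Suc i mod length c))}"
    by (auto simp: cyc_succ_def)
  then show ?thesis
    using even_card_changes_iff[of "length c" "\<lambda>i. p (c ! (i mod length c))"] by simp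
qed

lemma rainbow_cycle_imp_odd:
  assumes "rainbow_cycle n k c" "n > 0"
  shows "odd n"
proof -
  let ?I = "{i. i < length c \<and> 1 \<in> step_label c i}"
  have "bij_betw (step_label c) {..<length c} (flip_verts n 2)"
    using assms(1) by (simp add: rainbow_cycle_iff_bij_betw)
  then have "bij_betw (step_label c) ?I {P \<in> flip_verts n 2. 1 \<in> P}"
    using bij_betw_Collect[of "step_label c" "{..<length c}" _ "\<lambda>P. 1 \<in> P"] by simp
  then have "card ?I = n - 1"
    using card_flip_verts_containing[of 1 n 1] assms(2)
    by (simp add: bij_betw_same_card numeral_2_eq_2)
  moreover have "?I = {i. i < length c \<and> (1 \<in> c ! i) \<noteq> (1 \<in> cyc_succ c i)}"
    by (auto simp: step_label_def flip_label_def)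
  then have "even (card ?I)"
    using even_card_cyclic_changes[of c "\<lambda>A. 1 \<in> A"] by simp
  ultimately show ?thesis
    using assms(2) by simp
qed

section \<open>Residues\<close>

lemma cong_iff_eq_if_abs_diff_less:
  fixes a b m :: int
  assumes "\<bar>a - b\<bar> < m"
  shows "[a = b] (mod m) \<longleftrightarrow> a = b"
  using assms dvd_imp_le_int[of "a - b" m] by (auto simp: cong_iff_dvd_diff)

lemma cong_uminus_self_iff:
  fixes a m :: int
  assumes "odd m"
  shows "[a = - a] (mod m) \<longleftrightarrow> [a = 0] (mod m)"
proof -
  have "coprime m 2" using assms by simp
  then have "m dvd 2 * a \<longleftrightarrow> m dvd a" by (rule coprime_dvd_mult_right_iff)
  then show ?thesis by (simp add: cong_iff_dvd_diff)
qed

lemma cong_or_cong_uminus_imp_abs: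
  fixes u v m :: int
  assumes "[u = v] (mod m) \<or> [u = - v] (mod m)" "\<bar>u\<bar> < m" "\<bar>v\<bar> < m"
  shows "\<bar>u\<bar> = \<bar>v\<bar> \<or> \<bar>u\<bar> + \<bar>v\<bar> = m"
proof -
  have "m dvd u - v \<or> m dvd u + v"
    using assms(1) by (simp add: cong_iff_dvd_diff)
  then consider "m dvd \<bar>u\<bar> - \<bar>v\<bar>" | "m dvd \<bar>u\<bar> + \<bar>v\<bar> - m"
    by (cases "0 \<le> u"; cases "0 \<le> v") (auto simp: dvd_diff_commute add.commute)
  then show ?thesis
    using assms(2,3) by cases (auto dest: dvd_imp_le_int[rotated])
qed

definition sign_distinct_mod :: "int \<Rightarrow> nat \<Rightarrow> (nat \<Rightarrow> int) \<Rightarrow> bool" where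
  "sign_distinct_mod m l d \<longleftrightarrow> (\<forall>i<l. \<not> [d i = 0] (mod m)) \<and>
     (\<forall>i<l. \<forall>j<l. [d i = d j] (mod m) \<or> [d i = - d j] (mod m) \<longrightarrow> i = j)"

lemma sign_distinct_modI:
  fixes m :: nat
  assumes abs_eq: "\<And>i. i < l \<Longrightarrow> \<bar>d i\<bar> = int (s i)"
    and bounds: "\<And>i. i < l \<Longrightarrow> 0 < s i \<and> s i < m"
    and inj: "\<And>i j. i < l \<Longrightarrow> j < l \<Longrightarrow> s i = s j \<or> s i + s j = m \<Longrightarrow> i = j"
  shows "sign_distinct_mod (int m) l d"
  unfolding sign_distinct_mod_def
proof (intro conjI allI impI)
  fix i assume "i < l"
  then show "\<not> [d i = 0] (mod int m)"
    using abs_eq[of i] bounds[of i] by (subst cong_iff_eq_if_abs_diff_less) auto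
next
  fix i j assume ij: "i < l" "j < l" and "[d i = d j] (mod int m) \<or> [d i = - d j] (mod int m)"
  then have "int (s i) = int (s j) \<or> int (s i) + int (s j) = int m"
    using cong_or_cong_uminus_imp_abs[of "d i" "d j" "int m"] abs_eq bounds by simp
  then show "i = j"
    using inj[OF ij] by linarith
qed

lemma sign_distinct_mod_nonzero:
  "sign_distinct_mod m l d \<Longrightarrow> i < l \<Longrightarrow> \<not> [d i = 0] (mod m)"
  by (simp add: sign_distinct_mod_def)

lemma sign_distinct_mod_eqD:
  assumes "sign_distinct_mod m l d" "i < l" "j < l" "[d i = d j] (mod m)"
  shows "i = j"
  using assms by (auto simp: sign_distinct_mod_def)

lemma sign_distinct_mod_not_uminus:
  assumes "sign_distinct_mod m l d" "odd m" "i < l" "j < l"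
  shows "\<not> [d i = - d j] (mod m)"
proof
  assume "[d i = - d j] (mod m)"
  moreover from this have "i = j"
    using assms by (auto simp: sign_distinct_mod_def)
  ultimately show False
    using assms by (simp add: cong_uminus_self_iff sign_distinct_mod_def)
qed

locale residue_coords =
  fixes n :: nat and \<phi> :: "int \<Rightarrow> nat"
  assumes coord_eq_iff: "\<phi> y = \<phi> z \<longleftrightarrow> [y = z] (mod int n)"
    and coord_in: "\<phi> y \<in> {1..n}"

definition residue_coord :: "nat \<Rightarrow> int \<Rightarrow> nat" where
  "residue_coord n y = Suc (nat (y mod int n))"

lemma residue_coords_residue_coord:
  assumes "n > 0"
  shows "residue_coords n (residue_coord n)"
proof
  fix y z :: int
  show "residue_coord n y = residue_coord n z \<longleftrightarrow> [y = z] (mod int n)"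
    using assms by (simp add: residue_coord_def eq_nat_nat_iff cong_def)
  have "y mod int n < int n"
    using assms by simp
  then show "residue_coord n y \<in> {1..n}"
    using assms by (auto simp: residue_coord_def nat_less_iff Suc_le_eq)
qed

lemma (in residue_coords) residue_coords_uminus: "residue_coords n (\<lambda>y. \<phi> (- y))"
  by unfold_locales (use coord_in in \<open>auto simp: coord_eq_iff cong_minus_minus_iff\<close>)

section \<open>Rainbow blocks and their rotations\<close>

definition walker_set :: "nat \<Rightarrow> int \<Rightarrow> int set" where
  "walker_set k y = insert y {1..<int k}"

definition rotates_into :: "int \<Rightarrow> int \<Rightarrow> int set \<Rightarrow> int set \<Rightarrow> bool" where
  "rotates_into m b S T \<longleftrightarrow> (\<forall>y\<in>S. \<exists>z\<in>T. [b + y = z] (mod m))"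

lemma walker_set_2: "walker_set 2 y = {y, 1}"
  by (auto simp: walker_set_def)

text \<open>The two premises of \<open>rotation_inj\<close> say that rotation by \<open>b\<close> takes one set of residues to the
  other.\<close>

locale rainbow_block =
  fixes n l k :: nat and x :: "nat \<Rightarrow> int"
  assumes n_eq: "n = 2 * l + 1" and l_pos: "0 < l" and k_pos: "0 < k" and k_le: "k \<le> n"
    and start: "[x 0 = 0] (mod int n)" and finish: "[x l = int k] (mod int n)"
    and avoids: "\<And>i z. i \<le> l \<Longrightarrow> z \<in> {1..<int k} \<Longrightarrow> \<not> [x i = z] (mod int n)"
    and steps: "sign_distinct_mod (int n) l (\<lambda>i. x (Suc i) - x i)"
    and rotation_inj: "\<And>i j b. i < l \<Longrightarrow> j < l \<Longrightarrow>
      rotates_into (int n) b (walker_set k (x i)) (walker_set k (x j)) \<Longrightarrow>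
      rotates_into (int n) (- b) (walker_set k (x j)) (walker_set k (x i)) \<Longrightarrow>
      i = j \<and> [b = 0] (mod int n)"

locale rotated_rainbow_block = residue_coords n \<phi> + rainbow_block n l k x
  for n \<phi> l k x
begin

definition rotated :: "int \<Rightarrow> nat \<Rightarrow> nat set" where
  "rotated b i = (\<lambda>z. \<phi> (b + z)) ` walker_set k (x i)"

definition vertex :: "nat \<Rightarrow> nat set" where
  "vertex t = rotated (int (t div l)) (t mod l)"

definition block_cycle :: "nat set list" where
  "block_cycle = map vertex [0..<n * l]"

lemma coord_mem_rotated_iff:
  "\<phi> y \<in> rotated b i \<longleftrightarrow> (\<exists>z\<in>walker_set k (x i). [y = b + z] (mod int n))"
  by (auto simp: rotated_def coord_eq_iff)

lemma rotated_cong: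
  assumes "[b = b'] (mod int n)"
  shows "rotated b i = rotated b' i"
  unfolding rotated_def using assms by (intro image_cong) (auto simp: coord_eq_iff cong_add)

lemma rotated_last: "rotated b l = rotated (b + 1) 0"
proof -
  have last: "\<phi> (b + x l) = \<phi> (b + int k)" and first: "\<phi> (b + 1 + x 0) = \<phi> (b + 1 + 0)"
    using start finish by (simp_all only: coord_eq_iff cong_add_lcancel)
  have "rotated b l = (\<lambda>z. \<phi> (b + z)) ` insert (int k) {1..<int k}"
    by (simp add: rotated_def walker_set_def last)
  also have "insert (int k) {1..<int k} = (+) 1 ` insert 0 {1..<int k}"
    using k_pos by (auto simp: image_iff)
  also have "(\<lambda>z. \<phi> (b + z)) ` (+) 1 ` insert 0 {1..<int k} =
      (\<lambda>z. \<phi> (b + 1 + z)) ` insert 0 {1..<int k}"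
    by (simp only: image_image add.assoc)
  also have "\<dots> = rotated (b + 1) 0"
    by (simp only: rotated_def walker_set_def image_insert first)
  finally show ?thesis .
qed

lemma vertex_Suc: "vertex (Suc t) = rotated (int (t div l)) (Suc (t mod l))"
proof (cases "Suc (t mod l) = l")
  case True
  then show ?thesis
    by (simp add: vertex_def div_Suc mod_Suc rotated_last add.commute)
next
  case False
  then show ?thesis
    by (simp add: vertex_def div_Suc mod_Suc)
qed

lemma vertex_closed: "vertex (n * l) = vertex 0"
  using l_pos rotated_cong[of "int n" 0 0] by (simp add: vertex_def cong_iff_dvd_diff)

lemma inj_on_rotated:
  assumes "i \<le> l"
  shows "inj_on (\<lambda>z. \<phi> (b + z)) (walker_set k (x i))"
proof -
  have "inj_on (\<lambda>z. \<phi> (b + z)) {1..<int k}"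
  proof (rule inj_onI)
    fix y z assume "y \<in> {1..<int k}" "z \<in> {1..<int k}" "\<phi> (b + y) = \<phi> (b + z)"
    then show "y = z"
      using k_le by (auto simp: coord_eq_iff cong_add_lcancel cong_iff_eq_if_abs_diff_less)
  qed
  moreover have "\<phi> (b + x i) \<notin> (\<lambda>z. \<phi> (b + z)) ` {1..<int k}"
    using avoids[OF assms] by (auto simp: coord_eq_iff cong_add_lcancel)
  ultimately show ?thesis
    by (auto simp: walker_set_def)
qed

lemma rotated_in_flip_verts:
  assumes "i \<le> l"
  shows "rotated b i \<in> flip_verts n k"
proof -
  have "x i \<notin> {1..<int k}"
    using avoids[OF assms, of "x i"] by auto
  then have "card (walker_set k (x i)) = k"
    using k_pos by (simp add: walker_set_def)
  then have "card (rotated b i) = k"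
    by (simp add: rotated_def card_image inj_on_rotated[OF assms])
  then show ?thesis
    using coord_in by (auto simp: flip_verts_def rotated_def)
qed

lemma rotated_diff:
  assumes "i \<le> l" "\<not> [x i = x j] (mod int n)"
  shows "rotated b i - rotated b j = {\<phi> (b + x i)}"
proof -
  have "\<phi> (b + x i) \<notin> rotated b j"
    using assms avoids by (auto simp: coord_mem_rotated_iff walker_set_def cong_add_lcancel)
  then show ?thesis
    by (auto simp: rotated_def walker_set_def)
qed

lemma rotated_Suc_diff:
  assumes "i < l"
  shows "rotated b i - rotated b (Suc i) = {\<phi> (b + x i)}"
    and "rotated b (Suc i) - rotated b i = {\<phi> (b + x (Suc i))}"
    and "\<phi> (b + x i) \<noteq> \<phi> (b + x (Suc i))"
proof -
  have "\<not> [x (Suc i) = x i] (mod int n)"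
    using sign_distinct_mod_nonzero[OF steps assms] by (simp add: cong_diff_iff_cong_0)
  then show "rotated b i - rotated b (Suc i) = {\<phi> (b + x i)}"
    and "rotated b (Suc i) - rotated b i = {\<phi> (b + x (Suc i))}"
    and "\<phi> (b + x i) \<noteq> \<phi> (b + x (Suc i))"
    using assms by (simp_all add: rotated_diff coord_eq_iff cong_add_lcancel cong_sym_eq)
qed

lemma rotated_edge:
  assumes "i < l"
  shows "{rotated b i, rotated b (Suc i)} \<in> flip_edges n k"
  using assms rotated_Suc_diff[OF assms, of b]
  by (auto simp: doubleton_in_flip_edges_iff rotated_in_flip_verts)

lemma rotated_label:
  assumes "i < l"
  shows "flip_label (rotated b i) (rotated b (Suc i)) = {\<phi> (b + x i), \<phi> (b + x (Suc i))}"
  using rotated_Suc_diff[OF assms] by (simp add: flip_label_def insert_commute)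

lemma rotated_Int_Suc:
  assumes "i < l"
  shows "rotated b i \<inter> rotated b (Suc i) = (\<lambda>z. \<phi> (b + z)) ` {1..<int k}"
  using rotated_Suc_diff(3)[OF assms, of b] by (auto simp: rotated_def walker_set_def)

lemma rotates_into_if_rotated_subset:
  assumes "rotated b i \<subseteq> rotated b' j"
  shows "rotates_into (int n) (b - b') (walker_set k (x i)) (walker_set k (x j))"
  unfolding rotates_into_def
proof
  fix y assume "y \<in> walker_set k (x i)"
  then have "\<phi> (b + y) \<in> rotated b' j"
    using assms by (auto simp: rotated_def)
  then show "\<exists>z\<in>walker_set k (x j). [b - b' + y = z] (mod int n)"
    by (auto simp: coord_mem_rotated_iff cong_iff_dvd_diff algebra_simps)
qed

lemma rotated_inj:
  assumes "i < l" "j < l" "rotated b i = rotated b' j"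
  shows "i = j \<and> [b = b'] (mod int n)"
  using rotation_inj[of i j "b - b'"] assms rotates_into_if_rotated_subset[of b i b' j]
    rotates_into_if_rotated_subset[of b' j b i]
  by (simp add: cong_diff_iff_cong_0)

lemma rotated_label_inj:
  assumes ij: "i < l" "j < l"
    and eq: "{\<phi> (b + x i), \<phi> (b + x (Suc i))} = {\<phi> (b' + x j), \<phi> (b' + x (Suc j))}"
  shows "i = j \<and> [b = b'] (mod int n)"
proof -
  let ?d = "\<lambda>i. x (Suc i) - x i"
  consider (parallel) "[b + x i = b' + x j] (mod int n)"
      "[b + x (Suc i) = b' + x (Suc j)] (mod int n)"
    | (crossed) "[b + x i = b' + x (Suc j)] (mod int n)"
      "[b + x (Suc i) = b' + x j] (mod int n)"
    using eq by (auto simp: doubleton_eq_iff coord_eq_iff)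
  then show ?thesis
  proof cases
    case parallel
    have "[?d i = ?d j] (mod int n)"
      using cong_diff[OF parallel(2,1)] by simp
    then have "i = j"
      using sign_distinct_mod_eqD[OF steps ij] by simp
    then show ?thesis
      using parallel(1) by (simp add: cong_add_rcancel)
  next
    case crossed
    have "[?d i = - ?d j] (mod int n)"
      using cong_diff[OF crossed(2,1)] by simp
    then show ?thesis
      using sign_distinct_mod_not_uminus[OF steps _ ij] n_eq by simp
  qed
qed

lemma vertex_index_eqI:
  assumes "t < n * l" "t' < n * l"
    "t mod l = t' mod l \<and> [int (t div l) = int (t' div l)] (mod int n)"
  shows "t = t'"
proof -
  have "t div l < n" "t' div l < n"
    using assms(1,2) by (simp_all add: less_mult_imp_div_less)
  then have "t div l = t' div l"
    using assms(3) by (simp add: cong_iff_eq_if_abs_diff_less)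
  then show ?thesis
    using assms(3) by (metis div_mult_mod_eq)
qed

lemma rainbow_cycle_block_cycle: "rainbow_cycle n k block_cycle"
  unfolding block_cycle_def
proof (rule rainbow_cycle_map_upt)
  have mod_l_less: "t mod l < l" for t
    using l_pos by simp
  show "vertex (n * l) = vertex 0"
    by (rule vertex_closed)
  show "n * l = n choose 2"
    using n_eq by (simp add: choose_two)
  show "3 \<le> n * l"
    using n_eq l_pos mult_le_mono[of 3 n 1 l] by simp
  show "inj_on vertex {..<n * l}"
    using rotated_inj[OF mod_l_less mod_l_less]
    by (intro inj_onI vertex_index_eqI) (auto simp: vertex_def)
  show "{vertex t, vertex (Suc t)} \<in> flip_edges n k" for t
    unfolding vertex_Suc unfolding vertex_def by (rule rotated_edge[OF mod_l_less])
  have "flip_label (vertex t) (vertex (Suc t)) =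
      {\<phi> (int (t div l) + x (t mod l)), \<phi> (int (t div l) + x (Suc (t mod l)))}" for t
    unfolding vertex_Suc unfolding vertex_def by (rule rotated_label[OF mod_l_less])
  then show "inj_on (\<lambda>t. flip_label (vertex t) (vertex (Suc t))) {..<n * l}"
    using rotated_label_inj[OF mod_l_less mod_l_less] by (intro inj_onI vertex_index_eqI) auto
qed

lemma cycle_edges_block_cycleE:
  assumes "e \<in> cycle_edges block_cycle"
  obtains b i where "i < l" "e = {rotated b i, rotated b (Suc i)}"
proof -
  obtain t where "e = {vertex t, vertex (Suc t)}"
    using assms by (auto simp: block_cycle_def cycle_edges_map_upt[of vertex, OF vertex_closed])
  then have "e = {rotated (int (t div l)) (t mod l), rotated (int (t div l)) (Suc (t mod l))}"
    unfolding vertex_Suc by (simp add: vertex_def)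
  then show thesis
    using that[of "t mod l"] l_pos by simp
qed

end

lemma (in rainbow_block) ex_rainbow_cycle: "\<exists>c. rainbow_cycle n k c"
proof -
  interpret rotated_rainbow_block n "residue_coord n" l k x
    by (intro rotated_rainbow_block.intro residue_coords_residue_coord rainbow_block_axioms)
      (simp add: n_eq)
  show ?thesis
    using rainbow_cycle_block_cycle by blast
qed

section \<open>Two edge-disjoint rainbow Hamilton cycles on pairs\<close>

locale pair_block =
  fixes n l :: nat and x :: "nat \<Rightarrow> int"
  assumes n_eq: "n = 2 * l + 1" and l_pos: "0 < l"
    and start: "[x 0 = 0] (mod int n)" and finish: "[x l = 2] (mod int n)"
    and steps: "sign_distinct_mod (int n) l (\<lambda>i. x (Suc i) - x i)"
    and offsets: "sign_distinct_mod (int n) l (\<lambda>i. x i - 1)"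
begin

lemma rotation_inj:
  assumes ij: "i < l" "j < l"
    and "rotates_into (int n) b (walker_set 2 (x i)) (walker_set 2 (x j))"
    and "rotates_into (int n) (- b) (walker_set 2 (x j)) (walker_set 2 (x i))"
  shows "i = j \<and> [b = 0] (mod int n)"
proof (cases "[b = 0] (mod int n)")
  case True
  have "\<not> [x i = 1] (mod int n)"
    using sign_distinct_mod_nonzero[OF offsets ij(1)] by (simp add: cong_diff_iff_cong_0)
  then have "\<not> [b + x i = 1] (mod int n)"
    using cong_add_rcancel[of b "x i" 0] True by (auto intro: cong_trans cong_sym)
  then have "[b + x i = x j] (mod int n)"
    using assms(3) by (auto simp: rotates_into_def walker_set_2)
  then have "[x i = x j] (mod int n)"
    using cong_diff[OF _ True] by fastforce
  then have "[x i - 1 = x j - 1] (mod int n)"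
    by (simp add: cong_diff)
  then show ?thesis
    using sign_distinct_mod_eqD[OF offsets ij] True by simp
next
  case False
  then have "[b + 1 = x j] (mod int n)"
    using assms(3) by (auto simp: rotates_into_def walker_set_2 cong_add_rcancel_0)
  moreover have "\<not> [- b = 0] (mod int n)"
    using False cong_minus_minus_iff[of b 0] by simp
  then have "[- b + 1 = x i] (mod int n)"
    using assms(4) cong_add_rcancel_0[of "- b" 1] by (auto simp: rotates_into_def walker_set_2)
  ultimately have "[x i - 1 = - (x j - 1)] (mod int n)"
    using cong_add[of "b + 1" "x j" "int n" "- b + 1" "x i"]
    by (simp add: cong_iff_dvd_diff dvd_diff_commute algebra_simps)
  then show ?thesis
    using sign_distinct_mod_not_uminus[OF offsets _ ij] n_eq by simp
qed

sublocale rainbow_block n l 2 x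
proof
  show "[x l = int 2] (mod int n)"
    using finish by simp
  show "\<not> [x i = z] (mod int n)" if "i \<le> l" "z \<in> {1..<int 2}" for i z
  proof (cases "i = l")
    case True
    have "\<not> [2 = 1 :: int] (mod int n)"
      using n_eq l_pos by (simp add: cong_iff_dvd_diff)
    moreover have "z = 1"
      using that(2) by simp
    ultimately show ?thesis
      using finish True by (auto dest: cong_trans[OF cong_sym])
  next
    case False
    moreover have "z = 1"
      using that(2) by simp
    ultimately show ?thesis
      using that(1) sign_distinct_mod_nonzero[OF offsets, of i]
      by (simp add: cong_diff_iff_cong_0)
  qed
qed (use n_eq l_pos start steps rotation_inj in simp_all)

lemma offsets_uminusD:
  assumes "i < l" "j \<le> l" "[x i - 1 = - (x j - 1)] (mod int n)"
  shows "i = 0 \<and> j = l"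
proof -
  have "j = l"
    using sign_distinct_mod_not_uminus[OF offsets _ assms(1), of j] assms n_eq by force
  moreover have "i = 0"
  proof -
    have "[x l - 1 = - (x 0 - 1)] (mod int n)"
      using cong_add[OF start finish] by (simp add: cong_iff_dvd_diff algebra_simps)
    then have "[- (x l - 1) = x 0 - 1] (mod int n)"
      using cong_uminus by fastforce
    then have "[x i - 1 = x 0 - 1] (mod int n)"
      using assms(3) \<open>j = l\<close> cong_trans by blast
    then show ?thesis
      using sign_distinct_mod_eqD[OF offsets assms(1) l_pos] by simp
  qed
  ultimately show ?thesis by simp
qed

end

locale rotated_pair_block = residue_coords n \<phi> + pair_block n l x for n \<phi> l x
begin

sublocale rotated_rainbow_block n \<phi> l 2 x ..

sublocale reflected: rotated_rainbow_block n "\<lambda>y. \<phi> (- y)" l 2 x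
  by (intro rotated_rainbow_block.intro residue_coords_uminus rainbow_block_axioms)

text \<open>The edges of the cycle and of its reflection are compared through the common element and
  the symmetric difference of their ends.\<close>

lemma rotated_neq_reflected_rotated:
  assumes "2 \<le> l" and ij: "i < l" "j < l"
  shows "{rotated b i, rotated b (Suc i)} \<noteq> {reflected.rotated b' j, reflected.rotated b' (Suc j)}"
proof
  assume eq: "{rotated b i, rotated b (Suc i)} =
    {reflected.rotated b' j, reflected.rotated b' (Suc j)}"
  have "rotated b i \<inter> rotated b (Suc i) =
      reflected.rotated b' j \<inter> reflected.rotated b' (Suc j)"
    using eq by (auto simp: doubleton_eq_iff)
  moreover have "{1..<int 2} = {1}"
    by auto
  ultimately have centre: "[b + 1 = - (b' + 1)] (mod int n)"
    unfolding rotated_Int_Suc[OF ij(1)] reflected.rotated_Int_Suc[OF ij(2)]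
    by (simp add: coord_eq_iff)
  have "flip_label (rotated b i) (rotated b (Suc i)) =
      flip_label (reflected.rotated b' j) (reflected.rotated b' (Suc j))"
    using eq by (auto simp: doubleton_eq_iff flip_label_def)
  then consider (parallel) "[b + x i = - (b' + x j)] (mod int n)"
    | (crossed) "[b + x i = - (b' + x (Suc j))] (mod int n)"
      "[b + x (Suc i) = - (b' + x j)] (mod int n)"
    unfolding rotated_label[OF ij(1)] reflected.rotated_label[OF ij(2)]
    by (auto simp: doubleton_eq_iff coord_eq_iff)
  then show False
  proof cases
    case parallel
    then show False
      using cong_diff[OF parallel centre] offsets_uminusD[of i j] ij by simp
  next
    case crossed
    have "i = 0 \<and> Suc j = l"
      using cong_diff[OF crossed(1) centre] offsets_uminusD[of i "Suc j"] ij by simp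
    moreover have "j = 0"
      using cong_uminus[OF cong_diff[OF crossed(2) centre]] offsets_uminusD[of j "Suc i"] ij
      by (simp add: cong_sym)
    ultimately show False
      using assms by simp
  qed
qed

lemma cycle_edges_block_cycle_reflected_disjoint:
  assumes "2 \<le> l"
  shows "cycle_edges block_cycle \<inter> cycle_edges reflected.block_cycle = {}"
proof (intro equals0I, elim IntE)
  fix e assume "e \<in> cycle_edges block_cycle" "e \<in> cycle_edges reflected.block_cycle"
  then show False
    using rotated_neq_reflected_rotated[OF assms]
    by (elim cycle_edges_block_cycleE reflected.cycle_edges_block_cycleE) simp
qed

end

text \<open>Relative to the fixed element \<open>1\<close> the walk is \<open>-1, 2, -3, 4, \<dots>\<close>, with step lengths
  \<open>3, 5, \<dots>, 2 l - 1\<close>. Modulo sign and \<open>2 l + 1\<close> only the length \<open>1\<close> is missing, but closing up at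
  \<open>1\<close> would repeat a length. Keeping the sign once, just before index \<open>(l + 1) div 2\<close>, replaces
  exactly that repeated length by \<open>1\<close>.\<close>

definition pair_walk :: "nat \<Rightarrow> nat \<Rightarrow> int" where
  "pair_walk l i = (if i = l then 2 else
     1 + (if even i \<longleftrightarrow> i < (l + 1) div 2 then - (int i + 1) else int i + 1))"

definition pair_step_length :: "nat \<Rightarrow> nat \<Rightarrow> nat" where
  "pair_step_length l i = (if Suc i = l then (if even l then l + 1 else l - 1)
     else if Suc i = (l + 1) div 2 then 1 else 2 * i + 3)"

lemma abs_pair_walk_offset: "i < l \<Longrightarrow> \<bar>pair_walk l i - 1\<bar> = int i + 1"
  by (simp add: pair_walk_def)

lemma abs_pair_walk_step:
  assumes "2 \<le> l" "i < l"
  shows "\<bar>pair_walk l (Suc i) - pair_walk l i\<bar> = int (pair_step_length l i)"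
proof -
  consider (last) "Suc i = l" | (turn) "Suc i < l" "Suc i = (l + 1) div 2"
    | (alternating) "Suc i < l" "Suc i < (l + 1) div 2 \<longleftrightarrow> i < (l + 1) div 2"
      "Suc i \<noteq> (l + 1) div 2"
    using assms(2) by linarith
  then show ?thesis
  proof cases
    case last
    then have "\<not> i < (l + 1) div 2"
      using assms by auto
    then show ?thesis
      using last assms by (auto simp: pair_walk_def pair_step_length_def)
  next
    case turn
    then have "\<not> Suc i < (l + 1) div 2" "i < (l + 1) div 2" "i \<noteq> l" "Suc i \<noteq> l"
      by simp_all
    with turn(2)[symmetric] show ?thesis
      by (simp add: pair_walk_def pair_step_length_def)
  next
    case alternating
    then show ?thesis
      by (auto simp: pair_walk_def pair_step_length_def)
  qed
qed

lemma pair_step_length_bounds: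
  assumes "2 \<le> l" "i < l"
  shows "0 < pair_step_length l i \<and> pair_step_length l i < 2 * l + 1"
  using assms by (auto simp: pair_step_length_def)

lemma odd_pair_step_length_iff:
  assumes "2 \<le> l" "i < l"
  shows "odd (pair_step_length l i) \<longleftrightarrow> even l \<or> Suc i \<noteq> l"
  using assms by (simp add: pair_step_length_def)

lemma pair_step_length_inj:
  assumes "2 \<le> l" "i < l" "j < l"
    and "pair_step_length l i = pair_step_length l j \<or>
      pair_step_length l i + pair_step_length l j = 2 * l + 1"
  shows "i = j"
proof -
  have "pair_step_length l i + pair_step_length l j \<noteq> 2 * l + 1"
  proof
    assume sum: "pair_step_length l i + pair_step_length l j = 2 * l + 1"
    then have "odd (pair_step_length l i) \<noteq> odd (pair_step_length l j)"
      by presburger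
    then have "odd l" "(Suc i = l) \<noteq> (Suc j = l)"
      using odd_pair_step_length_iff[OF assms(1)] assms(2,3) by auto
    then have "pair_step_length l i = l - 1 \<or> pair_step_length l j = l - 1"
      by (auto simp: pair_step_length_def)
    then have "pair_step_length l i = l + 2 \<or> pair_step_length l j = l + 2"
      using sum assms(1) by linarith
    then show False
      using \<open>odd l\<close> by (auto simp: pair_step_length_def elim!: oddE split: if_splits)
  qed
  then have eq: "pair_step_length l i = pair_step_length l j"
    using assms(4) by blast
  then have "even l \<or> (Suc i = l \<longleftrightarrow> Suc j = l)"
    using odd_pair_step_length_iff[OF assms(1)] assms(2,3) by metis
  moreover obtain c where "(l + 1) div 2 = c" "even l \<and> 2 * c = l \<or> odd l \<and> 2 * c = l + 1"
    by (cases "even l") auto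
  ultimately show ?thesis
    using eq assms(1-3) unfolding pair_step_length_def
    by (simp only: split: if_splits) presburger+
qed

lemma pair_block_pair_walk:
  assumes "2 \<le> l"
  shows "pair_block (2 * l + 1) l (pair_walk l)"
proof
  show "sign_distinct_mod (int (2 * l + 1)) l (\<lambda>i. pair_walk l (Suc i) - pair_walk l i)"
    using abs_pair_walk_step[OF assms] pair_step_length_bounds[OF assms]
      pair_step_length_inj[OF assms] by (rule sign_distinct_modI)
  show "sign_distinct_mod (int (2 * l + 1)) l (\<lambda>i. pair_walk l i - 1)"
    by (rule sign_distinct_modI[of _ _ Suc]) (auto simp: abs_pair_walk_offset)
qed (use assms in \<open>simp_all add: pair_walk_def\<close>)

lemma ex_edge_disjoint_rainbow_hamilton_cycles:
  assumes "odd n" "5 \<le> n"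
  shows "\<exists>c d. rainbow_hamilton_cycle n 2 c \<and> rainbow_hamilton_cycle n 2 d \<and>
    cycle_edges c \<inter> cycle_edges d = {}"
proof -
  obtain l where n_eq: "n = 2 * l + 1"
    using assms(1) by (elim oddE)
  then have "2 \<le> l"
    using assms(2) by simp
  interpret rotated_pair_block n "residue_coord n" l "pair_walk l"
    using residue_coords_residue_coord[of n] pair_block_pair_walk[OF \<open>2 \<le> l\<close>] n_eq
    by (simp add: rotated_pair_block_def)
  show ?thesis
    using rainbow_cycle_block_cycle reflected.rainbow_cycle_block_cycle rainbow_cycle_2_imp_hamilton
      cycle_edges_block_cycle_reflected_disjoint[OF \<open>2 \<le> l\<close>] by blast
qed

section \<open>Rainbow blocks for larger sets\<close>

lemma rotates_into_mem:
  assumes "rotates_into n b S T" "T \<subseteq> {1..n}" "y \<in> S" "[b + y = z] (mod n)" "z \<in> {1..n}"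
  shows "z \<in> T"
proof -
  obtain z' where z': "z' \<in> T" "[b + y = z'] (mod n)"
    using assms(1,3) unfolding rotates_into_def by blast
  then have "[z = z'] (mod n)"
    using assms(4) by (blast intro: cong_trans cong_sym)
  moreover have "\<bar>z - z'\<bar> < n"
    using z'(1) assms(2,5) by fastforce
  ultimately show ?thesis
    using z'(1) by (simp add: cong_iff_eq_if_abs_diff_less)
qed

lemma walker_set_subset: "int k < y \<Longrightarrow> y \<le> n \<Longrightarrow> walker_set k y \<subseteq> {1..n}"
  by (auto simp: walker_set_def)

lemma rotates_into_run_imp:
  assumes k: "3 \<le> k" and y: "int k < y" "y \<le> n"
    and rot: "rotates_into n b {1..<int k} (walker_set k y)"
  shows "[b = 0] (mod n) \<or> [b = - 1] (mod n)"
proof -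
  note mem = rotates_into_mem[OF rot walker_set_subset[OF y]]
  define r where "r = (b + 1) mod n"
  have r: "[b + 1 = r] (mod n)" "0 \<le> r" "r < n"
    using k y by (simp_all add: r_def)
  have shift: "[b + (c + 1) = r + c] (mod n)" for c
    using cong_add[OF r(1) cong_refl[of c]] by (simp add: algebra_simps)
  consider (zero) "r = 0" | (one) "r = 1" | (inside) "2 \<le> r" "r < int k" | (beyond) "int k \<le> r"
    using r(2) by linarith
  then show ?thesis
  proof cases
    case zero
    then show ?thesis
      using r(1) by (simp add: cong_iff_dvd_diff)
  next
    case one
    then show ?thesis
      using r(1) by (simp add: cong_add_rcancel_0)
  next
    case inside
    then have "int k \<in> walker_set k y"
      using mem[of "int k - r + 1" "int k"] shift[of "int k - r"] y by simp
    then show ?thesis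
      using y by (simp add: walker_set_def)
  next
    case beyond
    then have "r \<in> walker_set k y" "r + 1 \<in> walker_set k y"
      using mem[of 1 r] mem[of 2 "r + 1"] shift[of 1] r k by simp_all
    then show ?thesis
      using beyond by (simp add: walker_set_def)
  qed
qed

text \<open>A rotation between two such sets can only shift the run \<open>1, \<dots>, k - 1\<close> by \<open>0\<close> or, onto a walker at
  \<open>n\<close>, by \<open>-1\<close>. The inverse rotation is of the same kind, which rules out \<open>-1\<close>.\<close>

lemma walker_set_rotation_inj:
  assumes k: "3 \<le> k" and y: "int k < y" "y \<le> n" and z: "int k < z" "z \<le> n"
    and rot: "rotates_into n b (walker_set k y) (walker_set k z)"
    and rot_back: "rotates_into n (- b) (walker_set k z) (walker_set k y)"
  shows "y = z \<and> [b = 0] (mod n)"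
proof -
  have "[b = 0] (mod n) \<or> [b = - 1] (mod n)"
    using k z rot by (intro rotates_into_run_imp) (auto simp: rotates_into_def walker_set_def)
  moreover have "[- b = 0] (mod n) \<or> [- b = - 1] (mod n)"
    using k y rot_back by (intro rotates_into_run_imp) (auto simp: rotates_into_def walker_set_def)
  moreover have "\<not> ([b = - 1] (mod n) \<and> [- b = - 1] (mod n))"
  proof (intro notI, elim conjE)
    assume "[b = - 1] (mod n)" "[- b = - 1] (mod n)"
    then have "n dvd 2"
      using cong_add[of b "- 1" n "- b" "- 1"] by (simp add: cong_iff_dvd_diff)
    then show False
      using k y dvd_imp_le_int[of 2 n] by simp
  qed
  moreover have "[- b = 0] (mod n) \<longleftrightarrow> [b = 0] (mod n)"
    using cong_minus_minus_iff[of b 0] by simp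
  ultimately have b: "[b = 0] (mod n)"
    by blast
  then have "[b + y = y] (mod n)"
    using cong_add_rcancel_0 by blast
  then have "y \<in> walker_set k z"
    using k y by (intro rotates_into_mem[OF rot walker_set_subset[OF z], of y])
      (auto simp: walker_set_def)
  then show ?thesis
    using b y by (auto simp: walker_set_def)
qed

lemma rainbow_blockI_run:
  assumes n_eq: "n = 2 * l + 1" and k: "3 \<le> k"
    and start: "x 0 = int n" and finish: "x l = int k"
    and bounds: "\<And>i. i < l \<Longrightarrow> int k < x i \<and> x i \<le> int n"
    and inj: "inj_on x {..<l}"
    and "sign_distinct_mod (int n) l (\<lambda>i. x (Suc i) - x i)"
  shows "rainbow_block n l k x"
proof
  show "0 < l"
    using n_eq k start finish by (cases "l = 0") auto
  then have k_less: "int k < int n"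
    using bounds[of 0] start by simp
  then show "k \<le> n"
    by simp
  show "[x 0 = 0] (mod int n)"
    by (simp add: start cong_iff_dvd_diff)
  show "\<not> [x i = z] (mod int n)" if "i \<le> l" "z \<in> {1..<int k}" for i z
  proof -
    have "int k \<le> x i \<and> x i \<le> int n"
      using that(1) bounds[of i] finish k_less by (cases "i = l") auto
    then show ?thesis
      using that(2) by (auto simp: cong_iff_eq_if_abs_diff_less)
  qed
  show "i = j \<and> [b = 0] (mod int n)" if ij: "i < l" "j < l"
    and "rotates_into (int n) b (walker_set k (x i)) (walker_set k (x j))"
      "rotates_into (int n) (- b) (walker_set k (x j)) (walker_set k (x i))" for i j b
    using walker_set_rotation_inj[OF k _ _ _ _ that(3,4)] bounds[OF ij(1)] bounds[OF ij(2)]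
      inj_onD[OF inj] ij by blast
qed (use assms in simp_all)

definition zigzag :: "nat \<Rightarrow> nat \<Rightarrow> int" where
  "zigzag m t = (if even t then int (t div 2) else int m - int (t div 2))"

lemma abs_zigzag_step: "\<bar>zigzag m (Suc t) - zigzag m t\<bar> = \<bar>int m - int t\<bar>"
  by (cases "even t") (auto simp: zigzag_def elim!: evenE oddE)

lemma zigzag_bounds:
  assumes "0 < t" "t \<le> m"
  shows "0 < zigzag m t \<and> zigzag m t \<le> int m"
  using assms by (cases "even t") (auto simp: zigzag_def elim!: evenE oddE)

lemma inj_on_zigzag: "inj_on (zigzag m) {..m}"
  by (rule inj_onI) (auto simp: zigzag_def elim!: evenE oddE split: if_splits)

lemma zigzag_self: "zigzag m m = int ((m + 1) div 2)"
  by (cases "even m") (auto simp: zigzag_def elim!: oddE)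

text \<open>The walk starts at \<open>n\<close>, which stands for the residue \<open>0\<close>, and spirals inwards with the steps
  \<open>l + d, l - 1, \<dots>, l - 2 p + 1\<close>, leaving out the length \<open>l - 2 q\<close>. It then jumps downwards by
  \<open>l - 2 q\<close> and spirals outwards with the steps \<open>1, \<dots>, l - 2 p\<close>, ending at \<open>k\<close>. The lengths \<open>l\<close> and
  \<open>l + 1\<close> agree modulo sign and \<open>n\<close>, so \<open>d\<close> is free to adjust the parity of the end point.\<close>

locale double_spiral =
  fixes l k p q d :: nat
  assumes q_pos: "1 \<le> q" and q_less: "q < p" and p_le: "2 * p \<le> l"
    and q_small: "2 * q < (l + 1) div 2" and d_le: "d \<le> 1"
    and closing: "2 * p + 2 * q + 1 = k + (l + 1) div 2 + d"
begin

definition walk :: "nat \<Rightarrow> int" where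
  "walk t = (if t = 0 then int (2 * l + 1)
     else if t < 2 * q then int (2 * l + 1) - int d - zigzag l t
     else if t < 2 * p then int (2 * l + 1) - int d - zigzag (l - 1) t
     else int k + zigzag (l - 2 * p) (l - t))"

definition step_length :: "nat \<Rightarrow> nat" where
  "step_length t = (if t = 0 then l + d
     else if t < 2 * q then l - t
     else if t < 2 * p - 1 then l - t - 1
     else if t = 2 * p - 1 then l - 2 * q
     else t + 1 - 2 * p)"

lemma walk_0: "walk 0 = int (2 * l + 1)"
  by (simp add: walk_def)

lemma walk_first_phase:
  "0 < t \<Longrightarrow> t \<le> 2 * q \<Longrightarrow> walk t = int (2 * l + 1) - int d - zigzag l t"
  using q_less by (auto simp: walk_def zigzag_def)

lemma walk_second_phase:
  "2 * q \<le> t \<Longrightarrow> t < 2 * p \<Longrightarrow> walk t = int (2 * l + 1) - int d - zigzag (l - 1) t"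
  using q_pos by (simp add: walk_def)

lemma walk_third_phase:
  "2 * p \<le> t \<Longrightarrow> walk t = int k + zigzag (l - 2 * p) (l - t)"
  using q_pos q_less by (simp add: walk_def)

lemma abs_walk_jump: "\<bar>walk (2 * p) - walk (2 * p - 1)\<bar> = int l - 2 * int q"
proof -
  have "zigzag (l - 1) (2 * p - 1) = int l - int p"
  proof -
    obtain h where "p = Suc h"
      using q_less by (cases p) auto
    then show ?thesis
      using p_le by (simp add: zigzag_def)
  qed
  then have "walk (2 * p - 1) = int l + 1 - int d + int p"
    using walk_second_phase[of "2 * p - 1"] q_less by simp
  moreover have "walk (2 * p) = int k + int ((l + 1) div 2) - int p"
    using walk_third_phase[of "2 * p"] zigzag_self[of "l - 2 * p"] p_le by auto
  ultimately show ?thesis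
    using closing q_small by linarith
qed

lemma abs_walk_step:
  assumes "t < l"
  shows "\<bar>walk (Suc t) - walk t\<bar> = int (step_length t)"
proof -
  consider (start) "t = 0" | (first) "0 < t" "t < 2 * q" | (second) "2 * q \<le> t" "t < 2 * p - 1"
    | (jump) "t = 2 * p - 1" | (third) "2 * p \<le> t"
    by linarith
  then show ?thesis
  proof cases
    case start
    then show ?thesis
      using walk_first_phase[of 1] q_pos by (simp add: walk_0 zigzag_def step_length_def)
  next
    case first
    then show ?thesis
      using abs_zigzag_step[of l t] assms
      by (simp add: walk_first_phase step_length_def abs_minus_commute)
  next
    case second
    then show ?thesis
      using abs_zigzag_step[of "l - 1" t] q_pos p_le
      by (simp add: walk_second_phase step_length_def abs_minus_commute)
  next
    case jump
    then show ?thesis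
      using abs_walk_jump q_less p_le by (simp add: step_length_def)
  next
    case third
    then have "Suc (l - Suc t) = l - t" "\<not> t < 2 * q" "\<not> t < 2 * p - 1"
        "t \<noteq> 2 * p - 1"
      using assms q_less by simp_all
    then show ?thesis
      using abs_zigzag_step[of "l - 2 * p" "l - Suc t"] third assms
      by (simp add: walk_third_phase step_length_def abs_minus_commute)
  qed
qed

lemma step_length_cases:
  assumes "t < l"
  obtains "t = 0" "step_length t = l + d"
    | "0 < t" "t < 2 * q" "step_length t + t = l"
    | "2 * q \<le> t" "t + 1 < 2 * p" "step_length t + t + 1 = l"
    | "t + 1 = 2 * p" "step_length t + 2 * q = l"
    | "2 * p \<le> t" "step_length t + 2 * p = t + 1"
proof -
  consider "t = 0" | "0 < t" "t < 2 * q" | "2 * q \<le> t" "t + 1 < 2 * p" | "t + 1 = 2 * p"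
    | "2 * p \<le> t" "\<not> t < 2 * q" "\<not> t < 2 * p - 1" "t \<noteq> 2 * p - 1"
    using q_less by linarith
  then show thesis
    using that q_pos q_less p_le assms by cases (simp_all add: step_length_def)
qed

lemma step_length_bounds:
  assumes "t < l"
  shows "0 < step_length t \<and> step_length t < 2 * l + 1"
  using assms by (cases t rule: step_length_cases) (use q_less p_le d_le assms in linarith)+

lemma step_length_inj:
  assumes "t < l" "t' < l"
    and "step_length t = step_length t' \<or> step_length t + step_length t' = 2 * l + 1"
  shows "t = t'"
proof -
  have "step_length r < l \<or> step_length r = l + d" if "r < l" for r
    using that by (cases r rule: step_length_cases) (use q_pos q_less p_le that in linarith)+
  from this[OF assms(1)] this[OF assms(2)] have "step_length t + step_length t' \<noteq> 2 * l + 1"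
    using d_le by presburger
  then have "step_length t = step_length t'"
    using assms(3) by blast
  with assms(1) show ?thesis
    by (cases t rule: step_length_cases; use assms(2) in \<open>cases t' rule: step_length_cases\<close>)
      (use assms q_pos q_less p_le in linarith)+
qed

lemma walk_inward_cases:
  assumes "t < 2 * p"
  obtains "t = 0" "walk t = int (2 * l + 1)"
    | h where "t = 2 * h" "0 < h" "h < p" "walk t = int (2 * l + 1) - int d - int h"
    | h where "t = 2 * h + 1" "h < q" "walk t = int (l + 1) - int d + int h"
    | h where "t = 2 * h + 1" "q \<le> h" "h < p" "walk t = int (l + 2) - int d + int h"
proof -
  consider "t = 0" | h where "t = 2 * h" "0 < h" | h where "t = 2 * h + 1"
    by (cases "t = 0"; cases "even t") (auto elim: evenE oddE)
  then show thesis
    using that assms p_le by cases (fastforce simp: walk_def zigzag_def)+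
qed

lemma walk_inward_bounds:
  assumes "t < 2 * p"
  shows "int l + 1 - int d \<le> walk t \<and> walk t \<le> int (2 * l + 1)"
  using assms by (cases t rule: walk_inward_cases) (use q_less p_le in linarith)+

lemma walk_outward_bounds:
  assumes "2 * p \<le> t" "t < l"
  shows "int k < walk t \<and> walk t < int l + 1 - int d"
  using zigzag_bounds[of "l - t" "l - 2 * p"] walk_third_phase[OF assms(1)] assms p_le closing
    q_small
  by linarith

lemma inj_on_walk_inward: "inj_on walk {..<2 * p}"
proof (rule inj_onI)
  fix t t' assume "t \<in> {..<2 * p}" "t' \<in> {..<2 * p}" and eq: "walk t = walk t'"
  then have t: "t < 2 * p" "t' < 2 * p"
    by simp_all
  from t(1) show "t = t'"
    by (cases t rule: walk_inward_cases; use t(2) in \<open>cases t' rule: walk_inward_cases\<close>)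
      (use eq q_less p_le in linarith)+
qed

lemma inj_on_walk: "inj_on walk {..<l}"
proof -
  have "inj_on walk {2 * p..<l}"
  proof (rule inj_onI)
    fix t t' assume t: "t \<in> {2 * p..<l}" "t' \<in> {2 * p..<l}" and "walk t = walk t'"
    then have "zigzag (l - 2 * p) (l - t) = zigzag (l - 2 * p) (l - t')"
      by (simp add: walk_third_phase)
    then have "l - t = l - t'"
      using t by (intro inj_onD[OF inj_on_zigzag, of "l - 2 * p"]) auto
    then show "t = t'"
      using t by auto
  qed
  moreover have "walk t' < walk t" if "t < 2 * p" "2 * p \<le> t'" "t' < l" for t t'
    using walk_inward_bounds[OF that(1)] walk_outward_bounds[OF that(2,3)] by linarith
  then have "walk ` {..<2 * p} \<inter> walk ` {2 * p..<l} = {}"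
    by fastforce
  ultimately have "inj_on walk ({..<2 * p} \<union> {2 * p..<l})"
    unfolding inj_on_Un using inj_on_walk_inward by blast
  moreover have "{..<2 * p} \<union> {2 * p..<l} = {..<l}"
    using p_le by auto
  ultimately show ?thesis
    by simp
qed

lemma rainbow_block_walk:
  assumes "3 \<le> k"
  shows "rainbow_block (2 * l + 1) l k walk"
proof (rule rainbow_blockI_run)
  show "walk 0 = int (2 * l + 1)"
    by (rule walk_0)
  show "walk l = int k"
    using walk_third_phase[OF p_le] by (simp add: zigzag_def)
  show "int k < walk t \<and> walk t \<le> int (2 * l + 1)" if "t < l" for t
    using walk_inward_bounds[of t] walk_outward_bounds[of t] that p_le q_small closing by linarith
  show "sign_distinct_mod (int (2 * l + 1)) l (\<lambda>t. walk (Suc t) - walk t)"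
    using abs_walk_step step_length_bounds step_length_inj by (rule sign_distinct_modI)
qed (use assms inj_on_walk in auto)

end

lemma ex_double_spiral:
  assumes "3 \<le> k" "3 * k < 2 * l + 1"
  obtains p q d where "double_spiral l k p q d"
proof -
  define c where "c = (l + 1) div 2"
  define d where "d = (k + c + 1) mod 2"
  define s where "s = (k + c + d) div 2"
  have c: "2 * c = l \<or> 2 * c = l + 1"
    unfolding c_def by linarith
  have d: "d \<le> 1"
    by (simp add: d_def)
  have "odd (k + c + d)"
    unfolding d_def by presburger
  then have s: "2 * s + 1 = k + c + d"
    unfolding s_def by simp
  show thesis
  proof (cases "2 * s \<le> l + 2")
    case True
    have "double_spiral l k (s - 1) 1 d"
      unfolding double_spiral_def c_def[symmetric] using True assms c d s by linarith
    then show thesis by (rule that)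
  next
    case False
    have "double_spiral l k (l div 2) (s - l div 2) d"
      unfolding double_spiral_def c_def[symmetric] using False assms c d s by linarith
    then show thesis by (rule that)
  qed
qed

lemma ex_rainbow_cycle:
  assumes "odd n" "3 \<le> k" "3 * k < n"
  shows "\<exists>c. rainbow_cycle n k c"
proof -
  obtain l where n_eq: "n = 2 * l + 1"
    using assms(1) by (elim oddE)
  obtain p q d where "double_spiral l k p q d"
    using ex_double_spiral assms(2,3) n_eq by blast
  then have "rainbow_block n l k (double_spiral.walk l k p q d)"
    using double_spiral.rainbow_block_walk assms(2) n_eq by simp
  then show ?thesis
    by (rule rainbow_block.ex_rainbow_cycle)
qed

theorem theorem15:
  fixes n k :: nat
  assumes "n \<ge> 4" and "2 \<le> k" and "k \<le> n div 2"
  shows "(even n \<longrightarrow> \<not> (\<exists>c. rainbow_cycle n k c)) \<and>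
    (odd n \<and> k = 2 \<longrightarrow> (\<exists>c. rainbow_hamilton_cycle n 2 c)) \<and>
    (odd n \<and> k = 2 \<longrightarrow> (\<exists>c d. rainbow_hamilton_cycle n 2 c \<and> rainbow_hamilton_cycle n 2 d \<and>
        cycle_edges c \<inter> cycle_edges d = {})) \<and>
    (odd n \<and> 3 \<le> k \<and> real k < real n / 3 \<longrightarrow> (\<exists>c. rainbow_cycle n k c))"
proof (intro conjI impI)
  show "\<not> (\<exists>c. rainbow_cycle n k c)" if "even n"
    using rainbow_cycle_imp_odd that assms(1) by fastforce
  show disjoint: "\<exists>c d. rainbow_hamilton_cycle n 2 c \<and> rainbow_hamilton_cycle n 2 d \<and>
      cycle_edges c \<inter> cycle_edges d = {}" if "odd n \<and> k = 2"
  proof -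
    have "n \<noteq> 4"
      using that by auto
    then show ?thesis
      using ex_edge_disjoint_rainbow_hamilton_cycles that assms(1) by simp
  qed
  show "\<exists>c. rainbow_hamilton_cycle n 2 c" if "odd n \<and> k = 2"
    using disjoint[OF that] by blast
  show "\<exists>c. rainbow_cycle n k c" if "odd n \<and> 3 \<le> k \<and> real k < real n / 3"
    using that by (intro ex_rainbow_cycle) auto
qed

end
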